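(* Let $S,k:\mathbb N\to\mathbb N^+$ and $p:\mathbb N\to(0,1)$ be such that each $p(N)$ has a finite binary representation $p(N)=0.b_1\dots b_{\ell}$ of length $\ell(p(N))\le 2\log(S(N))$, and $S(N)/N^{1/(k(N)+1)}\to 0$. Then there exists a $k$-wise independent random graph $\{\mathcal G^k(N,p)\}_N$ which, with probability tending to $1$ as $N\to\infty$, contains an independent set of size $S(N)$.
   Context: A $k$-wise independent random graph $\{\mathcal G^k(N,p)\}_N$ is a sequence, indexed by $N$, of probability distributions on simple undirected graphs with vertex set $\{1,\dots,N\}$ such that every potential edge appears with probability $p(N)$ and the indicator random variables of the appearance of any $k(N)$ potential edges are mutually independent. $\ell(p)$ denotes the length $\ell$ of the (finite) binary representation $p=0.b_1\dots b_\ell$. $\log$ is the base-2 logarithm. *)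

theory Defs
  imports "HOL-Probability.Probability"
begin

text \<open>A simple undirected graph on the vertex set \<open>{1..N}\<close> is represented by its edge set,
  a subset of \<open>potential_edges N\<close>.\<close>

definition potential_edges :: "nat \<Rightarrow> nat set set" where
  "potential_edges N = {e. e \<subseteq> {1..N} \<and> card e = 2}"

definition independent_set :: "nat \<Rightarrow> nat set set \<Rightarrow> nat set \<Rightarrow> bool" where
  "independent_set N E I \<longleftrightarrow> I \<subseteq> {1..N} \<and> (\<forall>u\<in>I. \<forall>v\<in>I. {u, v} \<notin> E)"

text \<open>Independence is required for all families of at most \<open>k N\<close> potential edges.  This is the same
  as requiring it for exactly \<open>k N\<close> edges when there are that many potential edges, and
  means full mutual independence (rather than no condition) when there are fewer.\<close>

definition kwise_independent_random_graph ::
    "(nat \<Rightarrow> nat) \<Rightarrow> (nat \<Rightarrow> real) \<Rightarrow> (nat \<Rightarrow> nat set set pmf) \<Rightarrow> bool" where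
  "kwise_independent_random_graph k p \<G> \<longleftrightarrow>
     (\<forall>N. set_pmf (\<G> N) \<subseteq> Pow (potential_edges N) \<and>
          (\<forall>e\<in>potential_edges N. measure_pmf.prob (\<G> N) {E. e \<in> E} = p N) \<and>
          (\<forall>J\<subseteq>potential_edges N. card J \<le> k N \<longrightarrow>
             prob_space.indep_vars (measure_pmf (\<G> N)) (\<lambda>_. borel)
               (\<lambda>e E. indicator E e :: real) J))"

definition has_binary_rep :: "real \<Rightarrow> nat \<Rightarrow> bool" where
  "has_binary_rep x l \<longleftrightarrow>
     (\<exists>b :: nat \<Rightarrow> nat. (\<forall>i. b i \<in> {0, 1}) \<and> x = (\<Sum>i=1..l. real (b i) / 2 ^ i))"

text \<open>Trailing zeros are not counted, hence the minimum.  The value is meaningful only if \<open>x\<close> has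
  some finite binary representation.\<close>

definition binary_length :: "real \<Rightarrow> nat" where
  "binary_length x = (LEAST l. has_binary_rep x l)"

end

theory Submission
  imports
    Defs
    "HOL-Computational_Algebra.Primes"
    "HOL-Computational_Algebra.Polynomial"
    "HOL-Real_Asymp.Real_Asymp"
begin

text \<open>Lines of an affine plane of prime order \<open>P\<close>, of order of magnitude \<open>N / S\<close>, give
  \<open>P\<^sup>2\<close> sets of \<open>S\<close> vertices no two of which share an edge.  The edges inside one such block are
  drawn from the non-vanishing of a random polynomial of degree less than \<open>k\<close> over \<open>\<int>/q\<close>, where the
  prime \<open>q\<close> is of order of magnitude \<open>S\<^sup>2\<close>, thinned by independent coins to reach the edge
  probability \<open>p\<close>; this is possible since the length of \<open>p\<close> gives \<open>p \<le> 1 - 1 / S\<^sup>2\<close>.  The zero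
  polynomial leaves the block empty with probability at least \<open>1 / q ^ k\<close>.  Blocks and
  remaining edges are independent, so all blocks are nonempty with probability at most
  \<open>exp (- P\<^sup>2 / q ^ k)\<close>, whose exponent is up to a factor \<open>c ^ k\<close> equal to
  \<open>(N / S ^ (k + 1))\<^sup>2\<close>; factors exponential in \<open>k\<close> are absorbed by
  \<open>S / N powr (1 / (k + 1)) \<longlonglongrightarrow> 0\<close>.\<close>

section \<open>Primes in multiplicative intervals\<close>

lemma prod_distinct_primes_dvd:
  fixes A :: "nat set"
  assumes "finite A" "\<And>p. p \<in> A \<Longrightarrow> prime p" "\<And>p. p \<in> A \<Longrightarrow> p dvd n"
  shows "\<Prod>A dvd n"
  using assms
proof (induction A rule: finite_induct)
  case (insert p A)
  have "coprime p (\<Prod>A)"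
    using insert by (intro prod_coprime_right) (auto intro!: primes_coprime)
  then show ?case
    using insert by (auto intro: divides_mult)
qed auto

text \<open>Erdos' induction. An even \<open>n > 2\<close> is not prime, so \<open>n - 1\<close> has
  the same primes below it. For \<open>n = 2 * m + 1\<close> the primes up to \<open>m + 1\<close>
  are covered by induction; those above divide the numerator of \<open>(2 * m + 1) choose m\<close>
  but neither factorial in its denominator, so their product divides this coefficient, which is at
  most \<open>4 ^ m\<close>.\<close>

lemma primorial_le: "\<Prod>{p. prime p \<and> p \<le> n} \<le> (4::nat) ^ n"
proof (induction n rule: less_induct)
  case (less n)
  consider "n = 0" | "n = 1" | "n = 2" | "n > 2" "even n" | m where "m > 0" "n = 2 * m + 1"
    by (metis One_nat_def add_0 gr0I less_one linorder_neqE_nat mult_0_right numeral_2_eq_2 oddE not_less_eq)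
  then show ?case
  proof cases
    case 1
    then have empty: "{p. prime p \<and> p \<le> n} = {}" by auto
    show ?thesis unfolding empty by simp
  next
    case 2
    then have empty: "{p. prime p \<and> p \<le> n} = {}" by (auto simp: le_Suc_eq prime_gt_0_nat)
    show ?thesis unfolding empty by simp
  next
    case 3
    then have "{p. prime p \<and> p \<le> n} = {2}" by (auto dest: prime_ge_2_nat)
    then show ?thesis using 3 by simp
  next
    case 4
    then have "{p. prime p \<and> p \<le> n} = {p. prime p \<and> p \<le> n - 1}"
      using prime_odd_nat[of n] by (auto simp: le_eq_less_or_eq)
    with less[of "n - 1"] 4 have "\<Prod>{p. prime p \<and> p \<le> n} \<le> (4::nat) ^ (n - 1)" by simp
    also have "\<dots> \<le> 4 ^ n" by (intro power_increasing) auto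
    finally show ?thesis .
  next
    case 5
    let ?B = "{p. prime p \<and> m + 1 < p \<and> p \<le> 2 * m + 1}"
    let ?c = "(2 * m + 1) choose m"
    have split: "{p. prime p \<and> p \<le> n} = {p. prime p \<and> p \<le> m + 1} \<union> ?B"
      using 5 by auto
    have "\<Prod>{p. prime p \<and> p \<le> n} = \<Prod>{p. prime p \<and> p \<le> m + 1} * \<Prod>?B"
      unfolding split by (rule prod.union_disjoint) auto
    moreover have "\<Prod>{p. prime p \<and> p \<le> m + 1} \<le> (4::nat) ^ (m + 1)"
      using less[of "m + 1"] 5 by simp
    moreover have "\<Prod>?B \<le> 4 ^ m"
    proof -
      have "\<Prod>?B dvd ?c"
      proof (rule prod_distinct_primes_dvd)
        fix p assume p: "p \<in> ?B"
        have "fact m * fact (m + 1) * ?c = (fact (2 * m + 1) :: nat)"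
          using binomial_fact_lemma[of m "2 * m + 1"] by simp
        moreover have "p dvd (fact (2 * m + 1) :: nat)"
          using p prime_dvd_fact_iff by blast
        moreover have "\<not> p dvd fact m" "\<not> p dvd fact (m + 1)"
          using p prime_dvd_fact_iff[of p m] prime_dvd_fact_iff[of p "m + 1"] by auto
        ultimately show "p dvd ?c"
          using p prime_dvd_mult_iff[of p] by (metis (no_types, lifting) mem_Collect_eq)
      qed auto
      moreover have "?c > 0" by simp
      ultimately have "\<Prod>?B \<le> ?c" by (rule dvd_imp_le)
      also have "?c \<le> 4 ^ m"
      proof -
        \<comment> \<open>The two middle entries of row \<open>2 * m + 1\<close> are equal, and the
          whole row sums to \<open>2 * 4 ^ m\<close>.\<close>
        have "2 * ?c = (\<Sum>i\<in>{m, m + 1}. (2 * m + 1) choose i)"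
          using binomial_symmetric[of m "2 * m + 1"] by simp
        also have "\<dots> \<le> (\<Sum>i\<le>2 * m + 1. (2 * m + 1) choose i)"
          by (intro sum_mono2) auto
        also have "\<dots> = 2 * 4 ^ m"
          unfolding choose_row_sum by (simp add: power_mult)
        finally show ?thesis by simp
      qed
      finally show ?thesis .
    qed
    ultimately have "\<Prod>{p. prime p \<and> p \<le> n} \<le> (4::nat) ^ (m + 1) * 4 ^ m"
      by (simp add: mult_le_mono)
    also have "\<dots> = 4 ^ n" using 5 by (simp flip: power_add add: mult_2)
    finally show ?thesis .
  qed
qed

text \<open>These quotients satisfy the recurrence of Leibniz' harmonic triangle.\<close>

lemma Lcm_over_binomial_Ints:
  assumes "\<And>i. 1 \<le> i \<Longrightarrow> i \<le> Suc n \<Longrightarrow> i dvd L" "k \<le> n"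
  shows "real L / (real (Suc n) * real (n choose k)) \<in> \<int>"
  using assms
proof (induction n arbitrary: k)
  case 0
  then show ?case by simp
next
  case (Suc n)
  note IHn = Suc.IH and prems = Suc.prems
  show ?case
    using prems(2)
  \<comment> \<open>Induction along the row: the left edge is \<open>L / (n + 2)\<close>, and each
    further entry is the entry at \<open>k\<close> in the row above minus its left neighbour, both
    integers.\<close>
  proof (induction k)
    case 0
    from prems(1)[of "Suc (Suc n)"] obtain c where "L = Suc (Suc n) * c" by auto
    then have "real L / (real (Suc (Suc n)) * real (Suc n choose 0)) = real c"
      by (metis binomial_n_0 mult.right_neutral of_nat_1 of_nat_mult nonzero_mult_div_cancel_left of_nat_eq_0_iff nat.distinct(1))
    then show ?case by (metis Ints_of_nat)
  next
    case (Suc k)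
    have 1: "real (Suc k) * real (Suc n choose Suc k) = real (Suc n) * real (n choose k)"
      by (metis Suc_times_binomial of_nat_mult)
    have 2: "(real n + 1 - real k) * real (Suc n choose k) = real (Suc n) * real (n choose k)"
      using binomial_absorb_comp[of "Suc n" k] Suc.prems
      by (metis (mono_tags, lifting) Suc_leD of_nat_Suc of_nat_diff of_nat_mult add.commute diff_Suc_1)
    let ?a = "real (n choose k)" and ?b = "real (Suc n choose Suc k)" and ?c = "real (Suc n choose k)"
    have pos: "?a > 0" "?b > 0" "?c > 0" using Suc.prems by (auto simp del: binomial_Suc_Suc)
    have n1: "real n + 1 - real k > 0" using Suc.prems by simp
    have b: "?b = real (Suc n) * ?a / real (Suc k)" using 1 by (simp add: field_simps del: of_nat_Suc)
    have c: "?c = real (Suc n) * ?a / (real n + 1 - real k)" using 2 n1 by (simp add: field_simps)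
    have "1 / (real (Suc (Suc n)) * ?b) = 1 / (real (Suc n) * ?a) - 1 / (real (Suc (Suc n)) * ?c)"
      unfolding b c using pos n1 by (simp add: divide_simps)
    then have "real L * (1 / (real (Suc (Suc n)) * ?b)) =
        real L * (1 / (real (Suc n) * ?a) - 1 / (real (Suc (Suc n)) * ?c))" by (rule arg_cong)
    then have "real L / (real (Suc (Suc n)) * ?b) =
        real L / (real (Suc n) * ?a) - real L / (real (Suc (Suc n)) * ?c)"
      by (simp only: right_diff_distrib times_divide_eq_right mult_1_right)
    moreover have "real L / (real (Suc n) * ?a) \<in> \<int>"
      using prems(1) Suc.prems by (intro IHn) auto
    moreover have "real L / (real (Suc (Suc n)) * ?c) \<in> \<int>"
      using Suc by auto
    ultimately show ?case by simp
  qed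
qed

text \<open>The multiplicity of a prime in an lcm is the maximum of the multiplicities, so a single
  element carries the whole power. Here \<open>e > 0\<close> rules out the empty set, whose lcm is
  1.\<close>

lemma prime_power_dvd_Lcm:
  fixes A :: "nat set"
  assumes "prime p" "finite A" "p ^ e dvd Lcm A" "e > 0"
  shows "\<exists>a\<in>A. p ^ e dvd a"
  using assms(2,3)
proof (induction A rule: finite_induct)
  case empty
  then show ?case using assms(1,4) by (auto dest: prime_gt_1_nat)
next
  case (insert a A)
  have "p ^ e dvd a \<or> p ^ e dvd Lcm A"
  proof (cases "a = 0 \<or> Lcm A = 0")
    case False
    then have "multiplicity p (lcm a (Lcm A)) = max (multiplicity p a) (multiplicity p (Lcm A))"
      using assms(1) by (intro multiplicity_lcm) auto
    then show ?thesis
      using insert.prems False assms(1)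
        power_dvd_iff_le_multiplicity[of "lcm a (Lcm A)" p e]
        power_dvd_iff_le_multiplicity[of a p e] power_dvd_iff_le_multiplicity[of "Lcm A" p e]
      by (auto simp: not_prime_unit le_max_iff_disj lcm_eq_0_iff dest: prime_gt_1_nat)
  qed auto
  then show ?case using insert by blast
qed

text \<open>Integrality of the harmonic triangle entries makes \<open>n choose k\<close> a divisor
  of the lcm of \<open>1, ..., n + 1\<close>; the prime power then divides one of these
  numbers.\<close>

lemma prime_power_dvd_binomial_le:
  assumes "prime p" "p ^ e dvd (n choose k)" "k \<le> n"
  shows "p ^ e \<le> Suc n"
proof (cases "e = 0")
  case False
  define L where "L = Lcm {1..Suc n}"
  have "real L / (real (Suc n) * real (n choose k)) \<in> \<int>"
    unfolding L_def using assms by (intro Lcm_over_binomial_Ints) auto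
  then obtain z where z: "real L / (real (Suc n) * real (n choose k)) = of_int z" by (elim Ints_cases)
  have "real (n choose k) > 0" using assms(3) by simp
  then have "real L = of_int z * (real (Suc n) * real (n choose k))"
    using z by (subst (asm) nonzero_divide_eq_eq) auto
  then have "int L = z * (int (Suc n) * int (n choose k))"
    by (metis (mono_tags) of_int_eq_iff of_int_mult of_int_of_nat_eq)
  then have "int (n choose k) dvd int L" by auto
  then have "p ^ e dvd L" using assms(2) by (meson dvd_trans int_dvd_int_iff)
  then obtain a where "a \<in> {1..Suc n}" "p ^ e dvd a"
    using prime_power_dvd_Lcm[OF assms(1), of "{1..Suc n}" e] False unfolding L_def by auto
  then show ?thesis using dvd_imp_le[of "p ^ e" a] by auto
qed simp

text \<open>Split the prime divisors at \<open>sqrt (Suc m)\<close>. There are at most that many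
  small ones, each contributing a prime power of at most \<open>Suc m\<close>. A large one has
  multiplicity 1, since its square already exceeds \<open>Suc m\<close>, and by assumption it is at
  most \<open>n\<close>; so the large ones together contribute at most the primorial of
  \<open>n\<close>.\<close>

lemma binomial_le_of_no_primes:
  assumes "\<And>p. prime p \<Longrightarrow> n < p \<Longrightarrow> p \<le> Suc m \<Longrightarrow> False" "k \<le> m"
  shows "real (m choose k) \<le> real (Suc m) powr sqrt (real (Suc m)) * 4 ^ n"
proof -
  define c where "c = m choose k"
  have c: "c > 0" using assms by (simp add: c_def)
  define A where "A = {p \<in> prime_factors c. p\<^sup>2 \<le> Suc m}"
  define B where "B = {p \<in> prime_factors c. \<not> p\<^sup>2 \<le> Suc m}"
  have fin: "finite A" "finite B" by (auto simp: A_def B_def)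
  have pp: "p ^ multiplicity p c \<le> Suc m" if "p \<in> prime_factors c" for p
    using that assms(2) by (intro prime_power_dvd_binomial_le[of p _ m k]) (auto simp: c_def multiplicity_dvd)
  have mult1: "multiplicity p c = 1" if "p \<in> B" for p
  proof (rule ccontr)
    assume "multiplicity p c \<noteq> 1"
    moreover have "multiplicity p c > 0" using that by (auto simp: B_def prime_factors_multiplicity)
    ultimately have "2 \<le> multiplicity p c" by linarith
    moreover have "p > 0" using that by (auto simp: B_def intro: prime_gt_0_nat)
    ultimately have "p\<^sup>2 \<le> p ^ multiplicity p c" by (intro power_increasing) auto
    also have "\<dots> \<le> Suc m" using that pp by (auto simp: B_def)
    finally show False using that by (auto simp: B_def)
  qed
  have "c = (\<Prod>p\<in>prime_factors c. p ^ multiplicity p c)"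
    using c by (simp add: prime_factorization_nat)
  also have "prime_factors c = A \<union> B" by (auto simp: A_def B_def)
  also have "(\<Prod>p\<in>A \<union> B. p ^ multiplicity p c) =
      (\<Prod>p\<in>A. p ^ multiplicity p c) * (\<Prod>p\<in>B. p ^ multiplicity p c)"
    using fin by (intro prod.union_disjoint) (auto simp: A_def B_def)
  also have "\<dots> \<le> Suc m ^ card A * 4 ^ n"
  proof (rule mult_le_mono)
    have "(\<Prod>p\<in>A. p ^ multiplicity p c) \<le> (\<Prod>p\<in>A. Suc m)"
      using pp by (intro prod_mono) (auto simp: A_def)
    then show "(\<Prod>p\<in>A. p ^ multiplicity p c) \<le> Suc m ^ card A" by simp
    have sub: "B \<subseteq> {p. prime p \<and> p \<le> n}"
    proof
      fix p assume p: "p \<in> B"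
      then have "p \<le> Suc m" using pp[of p] mult1[OF p] by (auto simp: B_def)
      then show "p \<in> {p. prime p \<and> p \<le> n}"
        using assms(1)[of p] p by (auto simp: B_def not_less[symmetric])
    qed
    have "(\<Prod>p\<in>B. p ^ multiplicity p c) = \<Prod>B" using mult1 by (intro prod.cong) auto
    also have "\<dots> \<le> \<Prod>{p. prime p \<and> p \<le> n}"
    proof (rule dvd_imp_le)
      show "\<Prod>B dvd \<Prod>{p. prime p \<and> p \<le> n}" using sub by (intro prod_dvd_prod_subset) auto
      show "\<Prod>{p. prime p \<and> p \<le> n} > (0::nat)" by (intro prod_pos) (auto intro: prime_gt_0_nat)
    qed
    also have "\<dots> \<le> 4 ^ n" by (rule primorial_le)
    finally show "(\<Prod>p\<in>B. p ^ multiplicity p c) \<le> 4 ^ n" .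
  qed
  finally have "real c \<le> real (Suc m ^ card A * 4 ^ n)" by (simp only: of_nat_le_iff)
  also have "\<dots> = real (Suc m) powr real (card A) * 4 ^ n"
    by (simp add: powr_realpow del: of_nat_Suc)
  also have "\<dots> \<le> real (Suc m) powr sqrt (real (Suc m)) * 4 ^ n"
  proof (intro mult_right_mono powr_mono)
    have "A \<subseteq> {1..nat \<lfloor>sqrt (real (Suc m))\<rfloor>}"
    proof
      fix p assume p: "p \<in> A"
      then have "(real p)\<^sup>2 \<le> real (Suc m)" by (auto simp: A_def simp flip: of_nat_power simp del: of_nat_Suc)
      then have "real p \<le> sqrt (real (Suc m))" by (rule real_le_rsqrt)
      moreover have "p \<ge> 1" using p prime_ge_1_nat by (auto simp: A_def)
      ultimately show "p \<in> {1..nat \<lfloor>sqrt (real (Suc m))\<rfloor>}" by (auto simp: le_nat_floor)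
    qed
    then have "card A \<le> nat \<lfloor>sqrt (real (Suc m))\<rfloor>" using card_mono[of "{1..nat \<lfloor>sqrt (real (Suc m))\<rfloor>}" A] by simp
    then have "real (card A) \<le> real (nat \<lfloor>sqrt (real (Suc m))\<rfloor>)"
      by (simp only: of_nat_le_iff)
    also have "\<dots> \<le> sqrt (real (Suc m))" by (rule of_nat_floor) simp
    finally show "real (card A) \<le> sqrt (real (Suc m))" .
  qed auto
  finally show ?thesis by (simp add: c_def)
qed

text \<open>Chebyshev's method: if no prime were in \<open>{n..5 * n}\<close>, the upper bound on
  \<open>(4 * n) choose (2 * n)\<close> above would contradict the growth of central binomial coefficients.\<close>

lemma prime_in_multiplicative_interval:
  "\<exists>C>0. \<forall>n>0. \<exists>p. prime p \<and> n \<le> p \<and> p \<le> C * (n::nat)"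
proof -
  \<comment> \<open>On the left is the bound of \<open>binomial_le_of_no_primes\<close> for
    \<open>m = 4 * n\<close>, on the right the lower bound for the central coefficient. The left
    side is \<open>4 powr x\<close> times a subexponential factor, so the right side wins
    eventually.\<close>
  have "eventually (\<lambda>x::real. (4 * x + 1) powr sqrt (4 * x + 1) * 4 powr x < 4 powr (2 * x) / (4 * x)) at_top"
    by real_asymp
  then have "eventually (\<lambda>n. (4 * real n + 1) powr sqrt (4 * real n + 1) * 4 powr real n <
      4 powr (2 * real n) / (4 * real n)) at_top"
    by (rule eventually_compose_filterlim) (rule filterlim_real_sequentially)
  then obtain n0 where n0: "\<And>n. n \<ge> n0 \<Longrightarrow>
      (4 * real n + 1) powr sqrt (4 * real n + 1) * 4 powr real n < 4 powr (2 * real n) / (4 * real n)"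
    by (auto simp: eventually_at_top_linorder)
  have large: "\<exists>p. prime p \<and> n \<le> p \<and> p \<le> 5 * n" if "n \<ge> n0" "n > 0" for n
  proof (rule ccontr)
    assume *: "\<not> ?thesis"
    have no_prime: False if "prime p" "n < p" "p \<le> Suc (2 * (2 * n))" for p
    proof -
      have "p \<le> 5 * n" using that \<open>n > 0\<close> by linarith
      then show False using * that(1,2) less_imp_le by blast
    qed
    have "4 ^ (2 * n) / (2 * real (2 * n)) \<le> real ((2 * (2 * n)) choose (2 * n))"
      using that by (intro central_binomial_lower_bound) auto
    also have "\<dots> \<le> real (Suc (2 * (2 * n))) powr sqrt (real (Suc (2 * (2 * n)))) * 4 ^ n"
      by (rule binomial_le_of_no_primes[OF no_prime]) auto
    finally show False using n0[OF that(1)] powr_realpow[of 4 n] powr_realpow[of 4 "2 * n"]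
      by (simp add: add.commute)
  qed
  \<comment> \<open>One prime beyond the threshold \<open>n0\<close> serves every smaller
    \<open>n\<close>, so the constant \<open>5 + q\<close> works for all
    \<open>n > 0\<close>.\<close>
  obtain q where q: "prime q" "q > n0" using bigger_prime by blast
  show ?thesis
  proof (rule exI[of _ "5 + q"], intro conjI allI impI)
    fix n :: nat assume "n > 0"
    show "\<exists>p. prime p \<and> n \<le> p \<and> p \<le> (5 + q) * n"
    proof (cases "n \<ge> n0")
      case True
      then obtain p where "prime p" "n \<le> p" "p \<le> 5 * n" using large \<open>n > 0\<close> by blast
      then show ?thesis by (intro exI[of _ p]) (auto simp: algebra_simps)
    next
      case False
      then have "q \<le> (5 + q) * n" using \<open>n > 0\<close>
        by (cases n) auto
      then show ?thesis using q False by (intro exI[of _ q]) auto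
    qed
  qed simp
qed

section \<open>Subset criterion for limited independence\<close>

text \<open>By inclusion-exclusion, \<open>k\<close>-wise independence of the membership indicators only needs to be
  tested on events of the form \<open>J \<subseteq> E\<close>.\<close>

definition subset_kwise :: "nat \<Rightarrow> real \<Rightarrow> 'a set \<Rightarrow> 'a set pmf \<Rightarrow> bool" where
  "subset_kwise k p V D \<longleftrightarrow> set_pmf D \<subseteq> Pow V \<and>
     (\<forall>J\<subseteq>V. card J \<le> k \<longrightarrow> measure_pmf.prob D {E. J \<subseteq> E} = p ^ card J)"

lemma subset_kwiseD:
  assumes "subset_kwise k p V D" "J \<subseteq> V" "card J \<le> k"
  shows "measure_pmf.prob D {E. J \<subseteq> E} = p ^ card J"
  using assms by (auto simp: subset_kwise_def)

lemma measure_pmf_prob_cong: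
  assumes "\<And>x. x \<in> set_pmf D \<Longrightarrow> x \<in> A \<longleftrightarrow> x \<in> B"
  shows "measure_pmf.prob D A = measure_pmf.prob D B"
  using assms by (intro measure_pmf.finite_measure_eq_AE) (auto simp: AE_measure_pmf_iff)

text \<open>A family with a single event is closed under intersection, so independence of the events
  passes to the sigma-algebras they generate. The preimage of any Borel set under an indicator is
  the event, its complement, the empty set or everything, hence lies in that sigma-algebra.\<close>

lemma indep_vars_indicator:
  assumes indep: "\<And>J. J \<subseteq> I \<Longrightarrow> finite J \<Longrightarrow>
      measure_pmf.prob D {E. J \<subseteq> E} = (\<Prod>e\<in>J. measure_pmf.prob D {E. e \<in> E})"
  shows "prob_space.indep_vars (measure_pmf D) (\<lambda>_. borel) (\<lambda>e E. indicator E e :: real) I"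
proof -
  let ?A = "\<lambda>e. {E. e \<in> E}"
  have "prob_space.indep_sets (measure_pmf D) (\<lambda>e. {?A e}) I"
  proof (rule prob_space.indep_setsI[OF prob_space_measure_pmf])
    fix A J assume J: "J \<subseteq> I" "finite J" and "\<forall>e\<in>J. A e \<in> {?A e}"
    then have A: "A e = ?A e" if "e \<in> J" for e using that by auto
    have "(\<Inter>e\<in>J. A e) = {E. J \<subseteq> E}" using A by auto
    then show "measure_pmf.prob D (\<Inter>e\<in>J. A e) = (\<Prod>e\<in>J. measure_pmf.prob D (A e))"
      using indep[OF J] A by simp
  qed auto
  then have sigma: "prob_space.indep_sets (measure_pmf D) (\<lambda>e. sigma_sets (space (measure_pmf D)) {?A e}) I"
    by (rule prob_space.indep_sets_sigma[OF prob_space_measure_pmf]) (auto simp: Int_stable_def)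
  show ?thesis
    unfolding prob_space.indep_vars_def2[OF prob_space_measure_pmf]
  proof (intro conjI ballI)
    show "prob_space.indep_sets (measure_pmf D)
        (\<lambda>e. {(\<lambda>E. indicator E e :: real) -` B \<inter> space (measure_pmf D) |B. B \<in> sets borel}) I"
    proof (rule prob_space.indep_sets_mono_sets[OF prob_space_measure_pmf sigma], rule subsetI)
      fix e X
      assume "X \<in> {(\<lambda>E. indicator E e :: real) -` B \<inter> space (measure_pmf D) |B. B \<in> sets borel}"
      then obtain B where X: "X = (\<lambda>E. indicator E e :: real) -` B" by auto
      let ?S = "sigma_sets UNIV {?A e}"
      have basic: "?A e \<in> ?S" by auto
      have "{} \<in> ?S" "UNIV \<in> ?S" "UNIV - ?A e \<in> ?S"
        using sigma_sets_top[of UNIV] by (auto intro: sigma_sets.intros)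
      moreover have "X = (if 1 \<in> B then if 0 \<in> B then UNIV else ?A e
          else if 0 \<in> B then UNIV - ?A e else {})"
        unfolding X by (auto simp: indicator_def of_bool_def split: if_splits)
      ultimately show "X \<in> sigma_sets (space (measure_pmf D)) {?A e}" using basic by auto
    qed
  qed auto
qed

lemma finite_potential_edges [simp]: "finite (potential_edges N)"
  by (rule finite_subset[of _ "Pow {1..N}"]) (auto simp: potential_edges_def)

lemma kwise_independent_random_graphI:
  assumes k: "\<And>N. k N > 0"
    and G: "\<And>N. subset_kwise (k N) (p N) (potential_edges N) (G N)"
  shows "kwise_independent_random_graph k p G"
  unfolding kwise_independent_random_graph_def
proof (intro allI conjI ballI impI)
  fix N
  show "set_pmf (G N) \<subseteq> Pow (potential_edges N)" using G by (auto simp: subset_kwise_def)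
  show edge: "measure_pmf.prob (G N) {E. e \<in> E} = p N" if "e \<in> potential_edges N" for e
    using subset_kwiseD[OF G, of "{e}" N] that k[of N] by simp
  fix J assume J: "J \<subseteq> potential_edges N" "card J \<le> k N"
  show "prob_space.indep_vars (measure_pmf (G N)) (\<lambda>_. borel) (\<lambda>e E. indicator E e :: real) J"
  proof (rule indep_vars_indicator)
    fix J' assume J': "J' \<subseteq> J" "finite J'"
    have "finite J" using J(1) by (rule finite_subset) simp
    then have "card J' \<le> k N" using J J' card_mono le_trans by blast
    then have "measure_pmf.prob (G N) {E. J' \<subseteq> E} = p N ^ card J'"
      using J J' by (intro subset_kwiseD[OF G]) auto
    also have "\<dots> = (\<Prod>e\<in>J'. measure_pmf.prob (G N) {E. e \<in> E})"
      using edge J J' by (simp add: subset_iff)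
    finally show "measure_pmf.prob (G N) {E. J' \<subseteq> E} = (\<Prod>e\<in>J'. measure_pmf.prob (G N) {E. e \<in> E})" .
  qed
qed

text \<open>Inclusion-exclusion one element at a time: forbidding \<open>x\<close> subtracts the
  event that \<open>x\<close> is required instead. Both events used from the induction stay within
  the budget of \<open>k\<close> constrained elements.\<close>

lemma subset_kwise_prob_disjoint:
  assumes "subset_kwise k p V D" "finite V" "A \<subseteq> V" "B \<subseteq> V" "A \<inter> B = {}" "card A + card B \<le> k"
  shows "measure_pmf.prob D {E. A \<subseteq> E \<and> B \<inter> E = {}} = p ^ card A * (1 - p) ^ card B"
proof -
  have "finite B" using assms finite_subset by blast
  then show ?thesis
    using assms(3-6)
  proof (induction B arbitrary: A rule: finite_induct)
    case empty
    then show ?case using subset_kwiseD[OF assms(1), of A] by simp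
  next
    case (insert x B)
    have fin: "finite A" using insert.prems assms(2) finite_subset by blast
    have "{E. A \<subseteq> E \<and> B \<inter> E = {}} =
        {E. A \<subseteq> E \<and> insert x B \<inter> E = {}} \<union> {E. insert x A \<subseteq> E \<and> B \<inter> E = {}}" by auto
    then have "measure_pmf.prob D {E. A \<subseteq> E \<and> B \<inter> E = {}} =
        measure_pmf.prob D ({E. A \<subseteq> E \<and> insert x B \<inter> E = {}} \<union> {E. insert x A \<subseteq> E \<and> B \<inter> E = {}})"
      by simp
    also have "\<dots> = measure_pmf.prob D {E. A \<subseteq> E \<and> insert x B \<inter> E = {}} +
        measure_pmf.prob D {E. insert x A \<subseteq> E \<and> B \<inter> E = {}}"
      by (rule measure_pmf.finite_measure_Union) auto
    also have "measure_pmf.prob D {E. insert x A \<subseteq> E \<and> B \<inter> E = {}} =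
        p ^ card (insert x A) * (1 - p) ^ card B"
      using insert.prems insert.hyps fin by (intro insert.IH) auto
    also have "measure_pmf.prob D {E. A \<subseteq> E \<and> B \<inter> E = {}} = p ^ card A * (1 - p) ^ card B"
      using insert.prems insert.hyps by (intro insert.IH) auto
    finally show ?case
      using insert fin by (simp add: algebra_simps)
  qed
qed

section \<open>Complements, intersections and disjoint unions of k-wise independent random
  sets\<close>

lemma subset_kwise_Compl:
  assumes "subset_kwise k p V D" "finite V"
  shows "subset_kwise k (1 - p) V (map_pmf (\<lambda>E. V - E) D)"
  unfolding subset_kwise_def
proof (intro conjI allI impI)
  fix J assume J: "J \<subseteq> V" "card J \<le> k"
  have "measure_pmf.prob (map_pmf (\<lambda>E. V - E) D) {E. J \<subseteq> E} =
      measure_pmf.prob D {E. {} \<subseteq> E \<and> J \<inter> E = {}}"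
    unfolding measure_map_pmf using J by (intro arg_cong[of _ _ "measure_pmf.prob D"]) auto
  also have "\<dots> = (1 - p) ^ card J"
    using subset_kwise_prob_disjoint[OF assms, of "{}" J] J by simp
  finally show "measure_pmf.prob (map_pmf (\<lambda>E. V - E) D) {E. J \<subseteq> E} = (1 - p) ^ card J" .
qed auto

text \<open>This is the thinning step: intersecting with an independent random set lowers the edge
  probability by the factor \<open>r\<close> and never creates an edge.\<close>

lemma subset_kwise_Int:
  assumes D: "subset_kwise k p V D" and D': "subset_kwise k r V D'" and "finite V"
  shows "subset_kwise k (p * r) V (map_pmf (\<lambda>(E, F). E \<inter> F) (pair_pmf D D'))"
  unfolding subset_kwise_def
proof (intro conjI allI impI)
  have sub: "set_pmf D \<subseteq> Pow V" "set_pmf D' \<subseteq> Pow V"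
    using D D' by (auto simp: subset_kwise_def)
  then show "set_pmf (map_pmf (\<lambda>(E, F). E \<inter> F) (pair_pmf D D')) \<subseteq> Pow V" by auto
  fix J assume J: "J \<subseteq> V" "card J \<le> k"
  \<comment> \<open>Cutting down to subsets of \<open>V\<close> makes the event finite, hence
    countable, as the product rule for \<open>pair_pmf\<close> demands.\<close>
  let ?X = "{E \<in> Pow V. J \<subseteq> E}"
  have "measure_pmf.prob (map_pmf (\<lambda>(E, F). E \<inter> F) (pair_pmf D D')) {E. J \<subseteq> E} =
      measure_pmf.prob (pair_pmf D D') (?X \<times> ?X)"
    unfolding measure_map_pmf by (rule measure_pmf_prob_cong) (use sub in auto)
  also have "\<dots> = measure_pmf.prob D ?X * measure_pmf.prob D' ?X"
    using \<open>finite V\<close> by (intro measure_pmf_prob_product countable_finite) auto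
  also have "measure_pmf.prob D ?X = measure_pmf.prob D {E. J \<subseteq> E}"
    by (rule measure_pmf_prob_cong) (use sub in auto)
  also have "measure_pmf.prob D' ?X = measure_pmf.prob D' {E. J \<subseteq> E}"
    by (rule measure_pmf_prob_cong) (use sub in auto)
  also have "measure_pmf.prob D {E. J \<subseteq> E} * measure_pmf.prob D' {E. J \<subseteq> E} = (p * r) ^ card J"
    using subset_kwiseD[OF D J] subset_kwiseD[OF D' J] by (simp add: power_mult_distrib)
  finally show "measure_pmf.prob (map_pmf (\<lambda>(E, F). E \<inter> F) (pair_pmf D D')) {E. J \<subseteq> E} =
      (p * r) ^ card J" .
qed

lemma prod_if_mem_eq_power_card:
  fixes r :: "'b :: comm_monoid_mult"
  assumes "finite V" "J \<subseteq> V"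
  shows "(\<Prod>x\<in>V. if x \<in> J then r else 1) = r ^ card J"
proof -
  have "(\<Prod>x\<in>V. if x \<in> J then r else 1) = (\<Prod>x\<in>V \<inter> J. r)"
    using assms(1) by (rule prod.inter_restrict[symmetric])
  then show ?thesis using assms(2) by (simp add: Int_absorb1)
qed

lemma subset_kwise_bernoulli:
  assumes "finite V" "0 \<le> r" "r \<le> 1"
  shows "subset_kwise k r V (map_pmf (\<lambda>f. {x \<in> V. f x}) (Pi_pmf V False (\<lambda>_. bernoulli_pmf r)))"
  unfolding subset_kwise_def
proof (intro conjI allI impI)
  fix J assume J: "J \<subseteq> V"
  have "measure_pmf.prob (map_pmf (\<lambda>f. {x \<in> V. f x}) (Pi_pmf V False (\<lambda>_. bernoulli_pmf r))) {E. J \<subseteq> E} =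
      measure_pmf.prob (Pi_pmf V False (\<lambda>_. bernoulli_pmf r)) (Pi V (\<lambda>x. if x \<in> J then {True} else UNIV))"
    unfolding measure_map_pmf using J
    by (intro arg_cong[of _ _ "measure_pmf.prob _"]) (auto simp: Pi_def split: if_splits)
  also have "\<dots> = (\<Prod>x\<in>V. measure_pmf.prob (bernoulli_pmf r) (if x \<in> J then {True} else UNIV))"
    using assms by (intro measure_Pi_pmf_Pi)
  also have "\<dots> = (\<Prod>x\<in>V. if x \<in> J then r else 1)"
    using assms by (intro prod.cong) (auto simp: measure_pmf_single)
  also have "\<dots> = r ^ card J" using assms(1) J by (rule prod_if_mem_eq_power_card)
  finally show "measure_pmf.prob (map_pmf (\<lambda>f. {x \<in> V. f x}) (Pi_pmf V False (\<lambda>_. bernoulli_pmf r)))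
      {E. J \<subseteq> E} = r ^ card J" .
qed auto

lemma Pi_pmf_support_subset:
  assumes "finite I" "f \<in> set_pmf (Pi_pmf I {} D)" "i \<in> I" "set_pmf (D i) \<subseteq> Pow (V i)"
  shows "f i \<subseteq> V i"
  using assms(2-4) set_Pi_pmf_subset'[OF assms(1), of "{}" D] by (auto simp: PiE_dflt_def)

text \<open>Disjointness lets \<open>J\<close> lie in the union exactly when each piece
  \<open>J \<inter> V i\<close> lies in its own component. Each piece has at most \<open>k\<close>
  elements, and the components are independent, so the powers of \<open>p\<close> multiply up to
  \<open>p ^ card J\<close>.\<close>

lemma subset_kwise_UN:
  assumes "finite I" "\<And>i. i \<in> I \<Longrightarrow> finite (V i)" "disjoint_family_on V I"
    and D: "\<And>i. i \<in> I \<Longrightarrow> subset_kwise k p (V i) (D i)"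
  shows "subset_kwise k p (\<Union>i\<in>I. V i) (map_pmf (\<lambda>f. \<Union>i\<in>I. f i) (Pi_pmf I {} D))"
  unfolding subset_kwise_def
proof (intro conjI allI impI)
  have sub: "f i \<subseteq> V i" if "f \<in> set_pmf (Pi_pmf I {} D)" "i \<in> I" for f i
    using Pi_pmf_support_subset[OF assms(1) that] D[OF that(2)] by (simp add: subset_kwise_def)
  then show "set_pmf (map_pmf (\<lambda>f. \<Union>i\<in>I. f i) (Pi_pmf I {} D)) \<subseteq> Pow (\<Union>i\<in>I. V i)" by fastforce
  fix J assume J: "J \<subseteq> (\<Union>i\<in>I. V i)" "card J \<le> k"
  have finJ: "finite J" using J(1) assms by (meson finite_UN finite_subset)
  have "measure_pmf.prob (map_pmf (\<lambda>f. \<Union>i\<in>I. f i) (Pi_pmf I {} D)) {E. J \<subseteq> E} =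
      measure_pmf.prob (Pi_pmf I {} D) (Pi I (\<lambda>i. {E. J \<inter> V i \<subseteq> E}))"
    unfolding measure_map_pmf
  proof (rule measure_pmf_prob_cong)
    fix f assume f: "f \<in> set_pmf (Pi_pmf I {} D)"
    have "J \<inter> V i \<subseteq> f i" if i: "i \<in> I" and cover: "J \<subseteq> (\<Union>i\<in>I. f i)" for i
    proof
      fix x assume x: "x \<in> J \<inter> V i"
      then obtain j where "j \<in> I" "x \<in> f j" using cover by auto
      moreover have "x \<in> V i \<inter> V j" using x sub[OF f \<open>j \<in> I\<close>] \<open>x \<in> f j\<close> by auto
      then have "j = i" using i \<open>j \<in> I\<close> assms(3) unfolding disjoint_family_on_def by blast
      ultimately show "x \<in> f i" by simp
    qed
    moreover have "J \<subseteq> (\<Union>i\<in>I. f i)" if "\<And>i. i \<in> I \<Longrightarrow> J \<inter> V i \<subseteq> f i"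
      using that J(1) by blast
    ultimately have "J \<subseteq> (\<Union>i\<in>I. f i) \<longleftrightarrow> (\<forall>i\<in>I. J \<inter> V i \<subseteq> f i)" by blast
    then show "f \<in> (\<lambda>f. \<Union>i\<in>I. f i) -` {E. J \<subseteq> E} \<longleftrightarrow> f \<in> Pi I (\<lambda>i. {E. J \<inter> V i \<subseteq> E})"
      by (simp add: Pi_iff)
  qed
  also have "\<dots> = (\<Prod>i\<in>I. measure_pmf.prob (D i) {E. J \<inter> V i \<subseteq> E})"
    using assms(1) by (rule measure_Pi_pmf_Pi)
  also have "\<dots> = (\<Prod>i\<in>I. p ^ card (J \<inter> V i))"
  proof (rule prod.cong)
    fix i assume i: "i \<in> I"
    have "card (J \<inter> V i) \<le> k" using J(2) finJ card_mono[of J "J \<inter> V i"] by auto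
    then show "measure_pmf.prob (D i) {E. J \<inter> V i \<subseteq> E} = p ^ card (J \<inter> V i)"
      using subset_kwiseD[OF D[OF i]] by simp
  qed simp
  also have "\<dots> = p ^ (\<Sum>i\<in>I. card (J \<inter> V i))" by (rule power_sum[symmetric])
  also have "(\<Sum>i\<in>I. card (J \<inter> V i)) = card (\<Union>i\<in>I. J \<inter> V i)"
    using assms(1,3) finJ by (intro card_UN_disjoint[symmetric]) (auto simp: disjoint_family_on_def)
  also have "(\<Union>i\<in>I. J \<inter> V i) = J" using J(1) by auto
  finally show "measure_pmf.prob (map_pmf (\<lambda>f. \<Union>i\<in>I. f i) (Pi_pmf I {} D)) {E. J \<subseteq> E} = p ^ card J" .
qed

text \<open>The complementary event restricts each coordinate of \<open>B\<close> separately, so its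
  probability is a product whose factors on \<open>B\<close> are at most
  \<open>1 - d\<close>.\<close>

lemma prob_Pi_pmf_ex_ge:
  assumes "finite I" "B \<subseteq> I" "0 \<le> d" "\<And>i. i \<in> B \<Longrightarrow> pmf (D i) z \<ge> d"
  shows "measure_pmf.prob (Pi_pmf I z' D) {f. \<exists>i\<in>B. f i = z} \<ge> 1 - (1 - d) ^ card B"
proof -
  have "measure_pmf.prob (Pi_pmf I z' D) (- {f. \<exists>i\<in>B. f i = z}) =
      measure_pmf.prob (Pi_pmf I z' D) (Pi I (\<lambda>i. if i \<in> B then - {z} else UNIV))"
    using assms(2) by (intro arg_cong[of _ _ "measure_pmf.prob _"]) (auto simp: Pi_def split: if_splits)
  also have "\<dots> = (\<Prod>i\<in>I. measure_pmf.prob (D i) (if i \<in> B then - {z} else UNIV))"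
    using assms(1) by (rule measure_Pi_pmf_Pi)
  also have "\<dots> \<le> (\<Prod>i\<in>I. if i \<in> B then 1 - d else 1)"
    using assms(4) by (intro prod_mono) (auto simp: measure_pmf.prob_compl[of "{z}", simplified] measure_pmf_single Compl_eq_Diff_UNIV)
  also have "\<dots> = (1 - d) ^ card B" using assms(1,2) by (rule prod_if_mem_eq_power_card)
  finally have "measure_pmf.prob (Pi_pmf I z' D) (- {f. \<exists>i\<in>B. f i = z}) \<le> (1 - d) ^ card B" .
  then show ?thesis
    using measure_pmf.prob_compl[of "{f. \<exists>i\<in>B. f i = z}" "Pi_pmf I z' D"]
    by (simp add: Compl_eq_Diff_UNIV)
qed

section \<open>Random polynomials over a prime field\<close>

text \<open>Lagrange's bound on the number of roots modulo \<open>q\<close>, phrased over the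
  integers: vanishing modulo \<open>q\<close> means divisibility by the constant polynomial
  \<open>[:q:]\<close>. Synthetic division at a root \<open>a\<close> leaves a remainder divisible
  by \<open>q\<close>; at the other points \<open>q\<close> does not divide \<open>x - a\<close>, so
  by primality the quotient vanishes there too.\<close>

lemma poly_prime_roots:
  fixes f :: "int poly"
  assumes "prime q" "finite A" "\<And>x. x \<in> A \<Longrightarrow> q dvd poly f x"
    and "\<And>x y. x \<in> A \<Longrightarrow> y \<in> A \<Longrightarrow> q dvd x - y \<Longrightarrow> x = y"
    and "degree f < card A"
  shows "[:q:] dvd f"
  using assms(2-5)
proof (induction A arbitrary: f rule: finite_induct)
  case (insert a A)
  define h where "h = synthetic_div f a"
  have f: "f = [:-a, 1:] * h + [:poly f a:]" unfolding h_def by (rule synthetic_div_correct'[symmetric])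
  have fa: "[:q:] dvd [:poly f a:]" using insert.prems(1)[of a] by (simp add: const_poly_dvd_const_poly_iff)
  show ?case
  proof (cases "degree f = 0")
    case True
    then have "h = 0" by (simp add: h_def synthetic_div_eq_0_iff)
    then show ?thesis using f fa by simp
  next
    case False
    have "[:q:] dvd h"
    proof (rule insert.IH)
      fix x assume x: "x \<in> A"
      have "poly f x = (x - a) * poly h x + poly f a" by (subst f) (simp add: algebra_simps)
      moreover have "q dvd poly f x" "q dvd poly f a" using insert.prems(1) x by auto
      ultimately have "q dvd (x - a) * poly h x" by (simp add: dvd_add_left_iff)
      moreover have "\<not> q dvd x - a" using insert x by auto
      ultimately show "q dvd poly h x" using assms(1) prime_dvd_mult_iff by blast
    next
      show "degree h < card A"
        using insert.prems(3) insert.hyps False by (simp add: h_def degree_synthetic_div)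
    qed (use insert.prems(2) in auto)
    then have "[:q:] dvd [:-a, 1:] * h + [:poly f a:]" using fa by (intro dvd_add dvd_mult)
    then show ?thesis using f by simp
  qed
qed auto

lemma eq_if_dvd_diff_of_bounds:
  fixes x y q :: int
  assumes "q dvd x - y" "0 \<le> x" "x < q" "0 \<le> y" "y < q"
  shows "x = y"
proof -
  have "x mod q = y mod q" using assms(1) by (simp add: mod_eq_dvd_iff)
  then show ?thesis using assms(2-5) by simp
qed

text \<open>Any values at the points of \<open>A\<close> can be prescribed once the coefficients of index at least
  \<open>card A\<close> are fixed: the map from coefficient vectors to those data is injective between sets of
  the same size.\<close>

lemma card_coeffs_vanishing:
  fixes A :: "int set"
  assumes q: "prime q" and A: "A \<subseteq> {0..<q}" and k: "card A \<le> k"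
  shows "card {c \<in> {..<k} \<rightarrow>\<^sub>E {0..<q}. \<forall>x\<in>A. q dvd (\<Sum>i<k. c i * x ^ i)} = nat q ^ (k - card A)"
proof -
  define a where "a = card A"
  define ev where "ev = (\<lambda>(c :: nat \<Rightarrow> int) x. \<Sum>i<k. c i * x ^ i)"
  define \<Phi> where "\<Phi> = (\<lambda>c. (restrict (\<lambda>x. ev c x mod q) A, restrict c {a..<k}))"
  define \<Omega> where "\<Omega> = {..<k} \<rightarrow>\<^sub>E {0..<q}"
  define T where "T = (A \<rightarrow>\<^sub>E {0..<q}) \<times> ({a..<k} \<rightarrow>\<^sub>E {0..<q})"
  have finA: "finite A" using A by (rule finite_subset) simp
  have q0: "q > 0" using q by (rule prime_gt_0_int)
  have finT: "finite T" unfolding T_def by (intro finite_cartesian_product finite_PiE) (use finA in auto)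
  have \<Phi>T: "\<Phi> ` \<Omega> \<subseteq> T"
  proof
    fix t assume "t \<in> \<Phi> ` \<Omega>"
    then obtain c where c: "c \<in> \<Omega>" "t = \<Phi> c" by blast
    have "restrict c {a..<k} \<in> {a..<k} \<rightarrow>\<^sub>E {0..<q}"
      using c(1) unfolding \<Omega>_def by (intro restrict_PiE_iff[THEN iffD2] ballI PiE_mem[of c]) auto
    moreover have "restrict (\<lambda>x. ev c x mod q) A \<in> A \<rightarrow>\<^sub>E {0..<q}"
      using q0 by (simp add: restrict_PiE_iff)
    ultimately show "t \<in> T" unfolding c(2) \<Phi>_def T_def by blast
  qed
  have inj: "inj_on \<Phi> \<Omega>"
  proof (rule inj_onI)
    fix c d assume c: "c \<in> \<Omega>" and d: "d \<in> \<Omega>" and eq: "\<Phi> c = \<Phi> d"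
    have tail: "c i = d i" if "i \<in> {a..<k}" for i
      using eq that by (auto simp: \<Phi>_def dest!: fun_cong[of _ _ i])
    have vals: "q dvd ev c x - ev d x" if "x \<in> A" for x
    proof -
      have "ev c x mod q = ev d x mod q"
        using eq that by (auto simp: \<Phi>_def dest!: fun_cong[of _ _ x])
      then show ?thesis by (simp add: mod_eq_dvd_iff)
    qed
    \<comment> \<open>Equal tails cancel, so the difference of the two polynomials has degree below
      \<open>card A\<close> and vanishes modulo \<open>q\<close> on \<open>A\<close>. Hence
      \<open>q\<close> divides all coefficient differences, and coefficients in
      \<open>{0..<q}\<close> must then agree.\<close>
    define f where "f = (\<Sum>i<a. monom (c i - d i) i)"
    have coeff_f: "coeff f i = (if i < a then c i - d i else 0)" for i
      by (simp add: f_def coeff_sum)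
    have poly_f: "poly f x = ev c x - ev d x" for x
    proof -
      have "ev c x - ev d x = (\<Sum>i<k. (c i - d i) * x ^ i)"
        by (simp add: ev_def sum_subtractf left_diff_distrib)
      also have "\<dots> = (\<Sum>i<a. (c i - d i) * x ^ i)"
        using k tail by (intro sum.mono_neutral_right) (auto simp: a_def)
      finally show ?thesis by (simp add: f_def poly_sum poly_monom)
    qed
    have "[:q:] dvd f"
    proof (cases "a = 0")
      case True
      then show ?thesis by (simp add: f_def)
    next
      case False
      have "degree f \<le> a - 1" by (rule degree_le) (auto simp: coeff_f)
      then have "degree f < card A" using False by (simp add: a_def)
      then show ?thesis
      proof (intro poly_prime_roots[OF q finA])
        fix x y assume "x \<in> A" "y \<in> A" "q dvd x - y"
        moreover from this have "x \<in> {0..<q}" "y \<in> {0..<q}" using A by blast+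
        ultimately show "x = y" using eq_if_dvd_diff_of_bounds[of q x y] by simp
      qed (auto simp: poly_f vals)
    qed
    then have dvd_coeff: "q dvd coeff f i" for i by (simp add: const_poly_dvd_iff)
    have "c i = d i" if "i < a" for i
    proof -
      have "i \<in> {..<k}" using that k by (simp add: a_def)
      then have "c i \<in> {0..<q}" "d i \<in> {0..<q}"
        using c d unfolding \<Omega>_def by (blast dest: PiE_mem)+
      moreover have "q dvd c i - d i" using dvd_coeff[of i] that by (simp add: coeff_f)
      ultimately show ?thesis using eq_if_dvd_diff_of_bounds[of q "c i" "d i"] by simp
    qed
    with tail have "c i = d i" if "i < k" for i using that by (cases "i < a") auto
    then show "c = d" using c d by (intro PiE_ext[of c "{..<k}"]) (auto simp: \<Omega>_def)
  qed
  have "card \<Omega> = nat q ^ k" unfolding \<Omega>_def by (simp add: card_PiE)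
  moreover have "card T = nat q ^ a * nat q ^ (k - a)"
    unfolding T_def card_cartesian_product using finA by (simp add: card_PiE a_def)
  then have "card T = nat q ^ k" using k by (simp add: a_def flip: power_add)
  ultimately have \<Phi>_onto: "\<Phi> ` \<Omega> = T"
    using card_image[OF inj] \<Phi>T finT by (intro card_subset_eq) auto
  let ?Z = "{c \<in> \<Omega>. \<forall>x\<in>A. q dvd ev c x}"
  \<comment> \<open>The vectors to be counted are the preimage of the all-zero value vector; only
    the \<open>k - a\<close> tail coefficients remain free.\<close>
  let ?T0 = "{restrict (\<lambda>_. 0 :: int) A} \<times> ({a..<k} \<rightarrow>\<^sub>E {0..<q})"
  have zero: "restrict (\<lambda>x. ev c x mod q) A = restrict (\<lambda>_. 0) A \<longleftrightarrow> (\<forall>x\<in>A. q dvd ev c x)" for c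
    by (auto simp: fun_eq_iff restrict_def dvd_eq_mod_eq_0)
  have "\<Phi> ` ?Z = ?T0"
  proof
    show "\<Phi> ` ?Z \<subseteq> ?T0"
    proof
      fix t assume "t \<in> \<Phi> ` ?Z"
      then obtain c where c: "c \<in> ?Z" "t = \<Phi> c" by blast
      then have "t \<in> T" using \<Phi>T by blast
      moreover have "fst t = restrict (\<lambda>_. 0) A" using c zero[of c] by (simp add: \<Phi>_def)
      ultimately show "t \<in> ?T0" by (simp add: T_def mem_Times_iff)
    qed
    show "?T0 \<subseteq> \<Phi> ` ?Z"
    proof
      fix t assume t: "t \<in> ?T0"
      then have "t \<in> T" using q0 by (auto simp: T_def)
      then obtain c where c: "c \<in> \<Omega>" "t = \<Phi> c" using \<Phi>_onto by blast
      then have "restrict (\<lambda>x. ev c x mod q) A = restrict (\<lambda>_. 0) A"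
        using t by (simp add: \<Phi>_def)
      then have "c \<in> ?Z" using c(1) zero[of c] by blast
      then show "t \<in> \<Phi> ` ?Z" using c(2) by blast
    qed
  qed
  moreover have "card (\<Phi> ` ?Z) = card ?Z" using inj by (intro card_image) (auto intro: inj_on_subset)
  ultimately have "card ?Z = card ?T0" by simp
  also have "\<dots> = nat q ^ (k - a)" by (simp add: card_cartesian_product card_PiE)
  finally show ?thesis by (simp add: \<Omega>_def ev_def a_def)
qed

text \<open>Label \<open>V\<close> by distinct residues and take the zero set of a uniformly random
  polynomial with \<open>k\<close> coefficients modulo \<open>q\<close>. Prescribing
  \<open>j \<le> k\<close> zeros leaves \<open>q ^ (k - j)\<close> of the \<open>q ^ k\<close>
  coefficient vectors, and the zero vector alone already yields all of \<open>V\<close>.\<close>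

lemma exists_subset_kwise_inverse_prime:
  fixes idx :: "'a \<Rightarrow> nat" and q :: nat
  assumes "prime q" "inj_on idx V" "idx ` V \<subseteq> {..<q}"
  shows "\<exists>D. subset_kwise k (1 / real q) V D \<and> pmf D V \<ge> 1 / real q ^ k"
proof -
  define \<Omega> where "\<Omega> = {..<k} \<rightarrow>\<^sub>E {0..<int q}"
  define Z where "Z c = {e \<in> V. int q dvd (\<Sum>i<k. c i * int (idx e) ^ i)}" for c
  define D where "D = map_pmf Z (pmf_of_set \<Omega>)"
  have q0: "q > 0" using assms(1) by (rule prime_gt_0_nat)
  have \<Omega>: "finite \<Omega>" "\<Omega> \<noteq> {}" "card \<Omega> = q ^ k"
    using q0 by (auto simp: \<Omega>_def card_PiE PiE_eq_empty_iff intro!: finite_PiE)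
  have D_prob: "measure_pmf.prob D X = real (card {c \<in> \<Omega>. Z c \<in> X}) / real q ^ k" for X
    unfolding D_def measure_map_pmf using \<Omega>
    by (simp add: measure_pmf_of_set Int_def vimage_def)
  have "measure_pmf.prob D {E. J \<subseteq> E} = (1 / real q) ^ card J" if J: "J \<subseteq> V" "card J \<le> k" for J
  proof -
    let ?A = "(\<lambda>e. int (idx e)) ` J"
    have "inj_on (\<lambda>e. int (idx e)) J"
      using assms(2) J(1) by (auto simp: inj_on_def)
    then have cardA: "card ?A = card J" by (rule card_image)
    have "{c \<in> \<Omega>. Z c \<in> {E. J \<subseteq> E}} = {c \<in> \<Omega>. \<forall>x\<in>?A. int q dvd (\<Sum>i<k. c i * x ^ i)}"
      using J(1) by (auto simp: Z_def)
    also have "card \<dots> = q ^ (k - card J)"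
    proof -
      have "?A \<subseteq> {0..<int q}" using assms(3) J(1) by (auto simp: image_subset_iff)
      then show ?thesis
        using card_coeffs_vanishing[of "int q" ?A k] assms(1) J(2) cardA unfolding \<Omega>_def by simp
    qed
    finally have "measure_pmf.prob D {E. J \<subseteq> E} = real q ^ (k - card J) / real q ^ k"
      by (simp add: D_prob)
    then show ?thesis using J(2) q0 by (simp add: power_diff field_simps)
  qed
  moreover have "set_pmf D \<subseteq> Pow V" using \<Omega> by (auto simp: D_def Z_def)
  ultimately have "subset_kwise k (1 / real q) V D" by (auto simp: subset_kwise_def)
  moreover have "pmf D V \<ge> 1 / real q ^ k"
  proof -
    have "restrict (\<lambda>_. 0) {..<k} \<in> {c \<in> \<Omega>. Z c \<in> {V}}" using q0 by (auto simp: \<Omega>_def Z_def)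
    then have "card {c \<in> \<Omega>. Z c \<in> {V}} > 0" using \<Omega>(1) by (subst card_gt_0_iff) auto
    then show ?thesis using D_prob[of "{V}"] q0 by (simp add: measure_pmf_single divide_right_mono)
  qed
  ultimately show ?thesis by blast
qed

text \<open>Complementing the random zero set gives membership probability \<open>1 - 1 / q\<close>
  and turns the zero polynomial into the empty set. Independent coins of bias
  \<open>p / (1 - 1 / q)\<close>, at most 1 by assumption, then lower the probability to
  \<open>p\<close>, and the empty set stays empty.\<close>

lemma exists_subset_kwise_often_empty:
  fixes idx :: "'a \<Rightarrow> nat" and q :: nat
  assumes "prime q" "finite V" "inj_on idx V" "idx ` V \<subseteq> {..<q}" "0 \<le> p" "p \<le> 1 - 1 / real q"
  shows "\<exists>D. subset_kwise k p V D \<and> pmf D {} \<ge> 1 / real q ^ k"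
proof -
  obtain Z where Z: "subset_kwise k (1 / real q) V Z" "pmf Z V \<ge> 1 / real q ^ k"
    using exists_subset_kwise_inverse_prime[OF assms(1,3,4)] by blast
  define r where "r = p / (1 - 1 / real q)"
  have q1: "1 - 1 / real q > 0" using prime_gt_1_nat[OF assms(1)] by simp
  have r: "0 \<le> r" "r \<le> 1" "(1 - 1 / real q) * r = p" using q1 assms(5,6) by (auto simp: r_def)
  define W where "W = map_pmf (\<lambda>E. V - E) Z"
  define B where "B = map_pmf (\<lambda>f. {x \<in> V. f x}) (Pi_pmf V False (\<lambda>_. bernoulli_pmf r))"
  define D where "D = map_pmf (\<lambda>(E, F). E \<inter> F) (pair_pmf W B)"
  have "subset_kwise k ((1 - 1 / real q) * r) V D"
    unfolding D_def W_def B_def using Z(1) assms(2) r(1,2)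
    by (intro subset_kwise_Int subset_kwise_Compl subset_kwise_bernoulli)
  moreover have "pmf D {} \<ge> 1 / real q ^ k"
  proof -
    have "1 / real q ^ k \<le> measure_pmf.prob Z {V}" using Z(2) by (simp add: measure_pmf_single)
    also have "\<dots> \<le> measure_pmf.prob W {{}}"
      unfolding W_def measure_map_pmf by (intro measure_pmf.finite_measure_mono) auto
    also have "\<dots> = measure_pmf.prob (map_pmf fst (pair_pmf W B)) {{}}" by (simp add: map_fst_pair_pmf)
    also have "\<dots> \<le> measure_pmf.prob D {{}}"
      unfolding D_def measure_map_pmf by (intro measure_pmf.finite_measure_mono) auto
    finally show ?thesis by (simp add: measure_pmf_single)
  qed
  ultimately show ?thesis using r(3) by auto
qed

section \<open>Edge-disjoint blocks\<close>

text \<open>The blocks are the lines \<open>y = a x + b\<close> of the affine plane over \<open>\<int>/P\<close>, restricted to \<open>S\<close>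
  columns: two of them share at most one point, so they have no edge in common.\<close>

lemma exists_edge_disjoint_blocks:
  assumes "prime P" "S \<le> P" "S * P \<le> N"
  shows "\<exists>blk :: nat \<times> nat \<Rightarrow> nat set.
    (\<forall>x\<in>{..<P} \<times> {..<P}. blk x \<subseteq> {1..N} \<and> card (blk x) = S) \<and>
    (\<forall>x\<in>{..<P} \<times> {..<P}. \<forall>y\<in>{..<P} \<times> {..<P}. \<forall>u v.
      x \<noteq> y \<longrightarrow> {u, v} \<subseteq> blk x \<longrightarrow> {u, v} \<subseteq> blk y \<longrightarrow> u = v)"
proof -
  \<comment> \<open>Column \<open>i\<close> occupies the vertices \<open>i * P + 1\<close> to
    \<open>i * P + P\<close>, and the line with slope \<open>a\<close> and intercept
    \<open>b\<close> meets it in one of them. Division by \<open>P\<close>, after removing the shift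
    by 1, recovers the column.\<close>
  define pt where "pt = (\<lambda>(a, b) i. i * P + (a * i + b) mod P + 1)"
  define blk where "blk = (\<lambda>x. pt x ` {..<S})"
  have P0: "P > 0" using assms(1) by (rule prime_gt_0_nat)
  have pt_eqD: "i = j \<and> (a * i + b) mod P = (a' * j + b') mod P"
    if "pt (a, b) i = pt (a', b') j" for a b a' b' i j
  proof -
    have *: "i * P + (a * i + b) mod P = j * P + (a' * j + b') mod P"
      using that by (simp add: pt_def)
    have "(i * P + (a * i + b) mod P) div P = i" "(j * P + (a' * j + b') mod P) div P = j"
      using P0 by simp_all
    then show ?thesis using * by simp
  qed
  have sub: "blk x \<subseteq> {1..N}" for x
  proof
    fix u assume "u \<in> blk x"
    then obtain a b i where u: "u = i * P + (a * i + b) mod P + 1" "i < S"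
      by (cases x) (auto simp: blk_def pt_def)
    have "u \<le> i * P + P" using P0 by (simp add: u(1) Suc_le_eq)
    also have "\<dots> = Suc i * P" by simp
    also have "\<dots> \<le> S * P" using u(2) by (intro mult_le_mono1) simp
    finally show "u \<in> {1..N}" using assms(3) u(1) by simp
  qed
  have card: "card (blk x) = S" for x
  proof -
    have "inj_on (pt x) {..<S}" by (cases x) (use pt_eqD in \<open>auto intro!: inj_onI\<close>)
    then show ?thesis by (simp add: blk_def card_image)
  qed
  have inter: "u = v"
    if x: "x \<in> {..<P} \<times> {..<P}" and y: "y \<in> {..<P} \<times> {..<P}" and "x \<noteq> y"
      and uv: "{u, v} \<subseteq> blk x" "{u, v} \<subseteq> blk y" for x y u v
  proof (rule ccontr)
    assume "u \<noteq> v"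
    obtain a b a' b' where xy: "x = (a, b)" "y = (a', b')" by (cases x, cases y)
    obtain i j where ij: "i < S" "j < S" "u = pt x i" "v = pt x j" using uv(1) by (auto simp: blk_def)
    obtain i' j' where "u = pt y i'" "v = pt y j'" using uv(2) by (auto simp: blk_def)
    then have eqs: "(a * i + b) mod P = (a' * i + b') mod P" "(a * j + b) mod P = (a' * j + b') mod P"
      using ij pt_eqD unfolding xy by metis+
    then have dvds: "int P dvd int (a * i + b) - int (a' * i + b')"
        "int P dvd int (a * j + b) - int (a' * j + b')"
      by (simp_all only: mod_eq_dvd_iff[symmetric] zmod_int[symmetric] of_nat_eq_iff)
    \<comment> \<open>Subtracting the two congruences eliminates the intercepts. Since
      \<open>i\<close> and \<open>j\<close> are distinct and below \<open>S \<le> P\<close>, the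
      prime \<open>P\<close> must divide the difference of the slopes.\<close>
    then have "int P dvd (int (a * i + b) - int (a' * i + b')) - (int (a * j + b) - int (a' * j + b'))"
      by (rule dvd_diff)
    also have "\<dots> = (int a - int a') * (int i - int j)" by (simp add: algebra_simps)
    finally have "int P dvd int a - int a' \<or> int P dvd int i - int j"
      using assms(1) by (simp add: prime_dvd_mult_iff)
    moreover have "i \<noteq> j" using \<open>u \<noteq> v\<close> ij by auto
    then have "\<not> int P dvd int i - int j"
      using eq_if_dvd_diff_of_bounds[of "int P" "int i" "int j"] ij(1,2) assms(2) by auto
    ultimately have "a = a'"
      using eq_if_dvd_diff_of_bounds[of "int P" "int a" "int a'"] x y xy by auto
    moreover from this have "b = b'"
      using eq_if_dvd_diff_of_bounds[of "int P" "int b" "int b'"] dvds(1) x y xy by auto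
    ultimately show False using \<open>x \<noteq> y\<close> xy by simp
  qed
  show ?thesis
  proof (intro exI[of _ blk] conjI ballI allI impI)
    fix x y u v
    assume "x \<in> {..<P} \<times> {..<P}" "y \<in> {..<P} \<times> {..<P}" "x \<noteq> y"
      "{u, v} \<subseteq> blk x" "{u, v} \<subseteq> blk y"
    then show "u = v" by (rule inter)
  qed (simp_all only: sub card)
qed

text \<open>The edges inside each block form one class, and classes are drawn independently. A block
  has at most \<open>S choose 2 \<le> q\<close> edges, enough room for distinct labels modulo
  \<open>q\<close>, so it can be drawn to be empty with probability at least
  \<open>1 / q ^ k\<close>. An empty block is an independent set of size \<open>S\<close>.\<close>

lemma exists_kwise_graph_of_blocks:
  fixes blk :: "'b \<Rightarrow> nat set" and q :: nat
  assumes "prime q" "S\<^sup>2 \<le> q" "0 \<le> p" "p \<le> 1 - 1 / real q" "finite X"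
    and blk: "\<And>x. x \<in> X \<Longrightarrow> blk x \<subseteq> {1..N} \<and> card (blk x) = S"
    and disj: "\<And>x y u v. x \<in> X \<Longrightarrow> y \<in> X \<Longrightarrow> x \<noteq> y \<Longrightarrow>
      {u, v} \<subseteq> blk x \<Longrightarrow> {u, v} \<subseteq> blk y \<Longrightarrow> u = v"
  shows "\<exists>G. subset_kwise k p (potential_edges N) G \<and>
    measure_pmf.prob G {E. \<exists>I. independent_set N E I \<and> card I = S} \<ge> 1 - (1 - 1 / real q ^ k) ^ card X"
proof -
  define W where "W x = {e \<in> potential_edges N. e \<subseteq> blk x}" for x
  \<comment> \<open>The index \<open>None\<close> collects the edges inside no block, so that the
    classes partition all potential edges.\<close>
  define V where "V = (\<lambda>i. case i of None \<Rightarrow> potential_edges N - (\<Union>x\<in>X. W x) | Some x \<Rightarrow> W x)"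
  define I where "I = insert None (Some ` X)"
  have finV: "finite (V i)" for i by (auto simp: V_def W_def split: option.splits)
  have "W x \<inter> W y = {}" if "x \<in> X" "y \<in> X" "x \<noteq> y" for x y
  proof (rule ccontr)
    assume "W x \<inter> W y \<noteq> {}"
    then obtain e where "e \<subseteq> blk x" "e \<subseteq> blk y" "card e = 2"
      by (auto simp: W_def potential_edges_def)
    then show False using disj[OF that] by (auto simp: card_2_iff)
  qed
  then have dV: "disjoint_family_on V I" by (auto simp: disjoint_family_on_def V_def I_def)
  have UV: "(\<Union>i\<in>I. V i) = potential_edges N" by (auto simp: V_def I_def W_def)
  have "\<exists>D. subset_kwise k p (V i) D \<and> (i \<noteq> None \<longrightarrow> pmf D {} \<ge> 1 / real q ^ k)" if "i \<in> I" for i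
  proof (cases i)
    case None
    have "p \<le> 1" using assms(4) by (rule order_trans) simp
    then show ?thesis using subset_kwise_bernoulli[OF finV assms(3)] None by blast
  next
    case (Some x)
    with that have x: "x \<in> X" by (auto simp: I_def)
    have fin: "finite (blk x)" using blk[OF x] finite_subset by blast
    have "card (W x) \<le> card {e. e \<subseteq> blk x \<and> card e = 2}"
      using fin by (intro card_mono) (auto simp: W_def potential_edges_def)
    also have "\<dots> = S choose 2" using n_subsets[OF fin] blk[OF x] by simp
    also have "\<dots> \<le> S\<^sup>2" by (simp add: choose_two power2_eq_square div_le_dividend[THEN le_trans])
    finally have "card (V i) \<le> card {..<q}" using assms(2) Some by (simp add: V_def)
    then obtain idx where "inj_on idx (V i)" "idx ` V i \<subseteq> {..<q}"
      using card_le_inj[OF finV, of "{..<q}" i] by auto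
    from exists_subset_kwise_often_empty[OF assms(1) finV this assms(3,4), of k]
    show ?thesis by blast
  qed
  then obtain D where D: "\<And>i. i \<in> I \<Longrightarrow> subset_kwise k p (V i) (D i)"
      and D0: "\<And>i. i \<in> I \<Longrightarrow> i \<noteq> None \<Longrightarrow> pmf (D i) {} \<ge> 1 / real q ^ k"
    by metis
  have finI: "finite I" using assms(5) by (simp add: I_def)
  define G where "G = map_pmf (\<lambda>f. \<Union>i\<in>I. f i) (Pi_pmf I {} D)"
  have "subset_kwise k p (\<Union>i\<in>I. V i) G"
    unfolding G_def using finI finV dV D by (rule subset_kwise_UN)
  moreover have "measure_pmf.prob G {E. \<exists>I. independent_set N E I \<and> card I = S} \<ge>
      1 - (1 - 1 / real q ^ k) ^ card X"
  proof -
    have "1 - (1 - 1 / real q ^ k) ^ card X = 1 - (1 - 1 / real q ^ k) ^ card (Some ` X)"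
      by (simp add: card_image)
    also have "\<dots> \<le> measure_pmf.prob (Pi_pmf I {} D) {f. \<exists>i\<in>Some ` X. f i = {}}"
      using finI D0 by (intro prob_Pi_pmf_ex_ge) (auto simp: I_def)
    also have "\<dots> \<le> measure_pmf.prob G {E. \<exists>I. independent_set N E I \<and> card I = S}"
      unfolding G_def measure_map_pmf
    proof (rule measure_pmf.finite_measure_mono_AE, unfold AE_measure_pmf_iff, intro ballI impI)
      fix f assume f: "f \<in> set_pmf (Pi_pmf I {} D)" and "f \<in> {f. \<exists>i\<in>Some ` X. f i = {}}"
      then obtain x where x: "x \<in> X" "f (Some x) = {}" by auto
      have "{u, v} \<notin> (\<Union>i\<in>I. f i)" if "u \<in> blk x" "v \<in> blk x" for u v
      proof
        assume "{u, v} \<in> (\<Union>i\<in>I. f i)"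
        then obtain i where i: "i \<in> I" "{u, v} \<in> f i" by blast
        have "f i \<subseteq> V i"
          using finI f i(1) by (rule Pi_pmf_support_subset) (use D[OF i(1)] in \<open>simp add: subset_kwise_def\<close>)
        with i(2) have "{u, v} \<in> V i" by blast
        \<comment> \<open>Any potential edge with both ends in the block of \<open>x\<close> belongs
          to the class of \<open>x\<close>, so it can only have been supplied by that component,
          which is empty. For \<open>u = v\<close> the singleton is no potential edge at
          all.\<close>
        moreover from this have "{u, v} \<in> V (Some x)"
          using that UV i(1) by (auto simp: V_def W_def)
        ultimately have "i = Some x"
          using dV i(1) x(1) unfolding disjoint_family_on_def I_def by blast
        then show False using i(2) x(2) by simp
      qed
      then have "independent_set N (\<Union>i\<in>I. f i) (blk x)"
        using blk[OF x(1)] by (auto simp: independent_set_def)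
      then show "f \<in> (\<lambda>f. \<Union>i\<in>I. f i) -` {E. \<exists>I. independent_set N E I \<and> card I = S}"
        using blk[OF x(1)] by auto
    qed auto
    finally show ?thesis .
  qed
  ultimately show ?thesis using UV by auto
qed

section \<open>Size estimates and assembly of the sequence of random graphs\<close>

lemma binary_rep_le_one_minus:
  assumes "has_binary_rep x l" "x < 1"
  shows "x \<le> 1 - 1 / 2 ^ l"
proof -
  obtain b :: "nat \<Rightarrow> nat" where x: "x = (\<Sum>i=1..l. real (b i) / 2 ^ i)"
    using assms(1) by (auto simp: has_binary_rep_def)
  \<comment> \<open>Scaling by \<open>2 ^ l\<close> turns \<open>x\<close> into a natural number;
    being strictly below \<open>2 ^ l\<close>, it is at most \<open>2 ^ l - 1\<close>.\<close>
  define m where "m = (\<Sum>i=1..l. b i * 2 ^ (l - i))"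
  have "x * 2 ^ l = (\<Sum>i=1..l. real (b i) * 2 ^ (l - i))"
    unfolding x sum_distrib_right by (intro sum.cong) (auto simp: power_diff)
  then have m: "x * 2 ^ l = real m" by (simp add: m_def)
  have "x * 2 ^ l < 1 * 2 ^ l" using assms(2) by (intro mult_strict_right_mono) auto
  then have "real m < real (2 ^ l)" using m by simp
  then have "m + 1 \<le> 2 ^ l" by (simp only: of_nat_less_iff)
  then have "real (m + 1) \<le> real (2 ^ l)" by (simp only: of_nat_le_iff)
  then have "x * 2 ^ l + 1 \<le> 2 ^ l" using m by simp
  then show ?thesis by (simp add: field_simps)
qed

lemma real_div_ge_half:
  fixes d n :: nat
  assumes "d > 0" "d \<le> n"
  shows "real (n div d) \<ge> real n / (2 * real d)"
proof -
  have "n div d \<ge> 1" using assms by (simp add: Suc_le_eq div_greater_zero_iff)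
  moreover have "real n / real d < real (n div d) + 1"
    using assms by (metis floor_divide_of_nat_eq of_int_of_nat_eq floor_less_cancel real_of_int_floor_add_one_gt)
  ultimately show ?thesis by (simp add: field_simps)
qed

lemma one_minus_power_le_exp:
  assumes "d \<le> (1 :: real)"
  shows "(1 - d) ^ m \<le> exp (- (real m * d))"
proof -
  have "(1 - d) ^ m \<le> exp (- d) ^ m"
    using assms exp_ge_add_one_self[of "- d"] by (intro power_mono) auto
  then show ?thesis by (simp flip: exp_of_nat_mult)
qed

text \<open>The parameter \<open>z\<close> stands for \<open>N powr (1 / (k + 1)) / S\<close>. With
  \<open>q \<le> C * S ^ 2\<close> and \<open>P\<close> at least \<open>N / (2 * S * C)\<close>, the
  exponent \<open>P ^ 2 / q ^ k\<close> is at least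
  \<open>(z / (2 * C)) ^ 2 * (z ^ 2 / C) ^ k\<close>. The second factor is at least 1 once
  \<open>z \<ge> C\<close>, which leaves a bound independent of \<open>k\<close>.\<close>

lemma exists_kwise_graph_with_independent_set:
  fixes S k N C :: nat and z p :: real
  assumes C: "C > 0" "\<And>n. n > 0 \<Longrightarrow> \<exists>p. prime p \<and> n \<le> p \<and> p \<le> C * n"
    and S: "S > 0" and k: "k > 0" and p: "0 \<le> p" "p \<le> 1 - 1 / real S ^ 2"
    and z: "z \<ge> 2 * real C" "real N = (z * real S) ^ (k + 1)"
  shows "\<exists>G. subset_kwise k p (potential_edges N) G \<and>
    measure_pmf.prob G {E. \<exists>I. independent_set N E I \<and> card I = S} \<ge> 1 - exp (- (z / (2 * real C))\<^sup>2)"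
proof -
  have C1: "real C \<ge> 1" and S1: "real S \<ge> 1" using C S by auto
  have z1: "z \<ge> 1" using z(1) C1 by linarith
  obtain q where q: "prime q" "S\<^sup>2 \<le> q" "q \<le> C * S\<^sup>2" using C(2)[of "S\<^sup>2"] S by auto
  have q0: "q > 0" using q(1) by (rule prime_gt_0_nat)
  have zS: "z * real S \<ge> real C * real S" using z(1) C1 S1 by (intro mult_right_mono) auto
  \<comment> \<open>This size of \<open>N\<close> is what makes \<open>n\<close>, and hence
    \<open>P\<close>, at least \<open>S\<close>, so that the plane has enough columns. It uses
    \<open>k + 1 \<ge> 2\<close>.\<close>
  have "real (S * C * S) \<le> (real C * real S)\<^sup>2"
    using C1 S1 by (simp add: power2_eq_square mult_left_mono)
  also have "\<dots> \<le> (z * real S)\<^sup>2" using zS by (intro power_mono) auto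
  also have "\<dots> \<le> (z * real S) ^ (k + 1)"
  proof (rule power_increasing)
    show "2 \<le> k + 1" using k by simp
    show "1 \<le> z * real S" using mult_mono[OF z1 S1] z1 by simp
  qed
  finally have N: "S * C * S \<le> N" using z(2) by (simp only: of_nat_le_iff)
  \<comment> \<open>The extra division by \<open>C\<close> pays for the prime being as large as
    \<open>C * n\<close>: the \<open>S\<close> columns of height \<open>P\<close> still fit into
    \<open>N\<close> vertices.\<close>
  define n where "n = N div (S * C)"
  have SC: "S * C > 0" "S * C \<le> N" using S C(1) N by (simp, metis le_trans mult_le_mono2 mult.right_neutral Suc_leI One_nat_def)
  have nS: "n \<ge> S" using N SC(1) by (simp add: n_def less_eq_div_iff_mult_less_eq mult.commute mult.left_commute)
  obtain P where P: "prime P" "n \<le> P" "P \<le> C * n" using C(2)[of n] nS S by auto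
  have "S * P \<le> S * C * n" using P(3) by simp
  also have "\<dots> \<le> N" unfolding n_def by (rule times_div_less_eq_dividend)
  finally have SP: "S * P \<le> N" .
  obtain blk :: "nat \<times> nat \<Rightarrow> nat set"
    where blk: "\<And>x. x \<in> {..<P} \<times> {..<P} \<Longrightarrow> blk x \<subseteq> {1..N} \<and> card (blk x) = S"
      and disj: "\<And>x y u v. x \<in> {..<P} \<times> {..<P} \<Longrightarrow> y \<in> {..<P} \<times> {..<P} \<Longrightarrow> x \<noteq> y \<Longrightarrow>
        {u, v} \<subseteq> blk x \<Longrightarrow> {u, v} \<subseteq> blk y \<Longrightarrow> u = v"
    using exists_edge_disjoint_blocks[OF P(1) le_trans[OF nS P(2)] SP] by metis
  have "1 / real q \<le> 1 / real S ^ 2"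
    using q(2) q0 S by (intro divide_left_mono) (auto simp flip: of_nat_power)
  then have pq: "p \<le> 1 - 1 / real q" using p(2) by linarith
  obtain G where G: "subset_kwise k p (potential_edges N) G"
      and prob: "measure_pmf.prob G {E. \<exists>I. independent_set N E I \<and> card I = S} \<ge>
        1 - (1 - 1 / real q ^ k) ^ card ({..<P} \<times> {..<P})"
  proof -
    have "\<exists>G. subset_kwise k p (potential_edges N) G \<and>
        measure_pmf.prob G {E. \<exists>I. independent_set N E I \<and> card I = S} \<ge>
        1 - (1 - 1 / real q ^ k) ^ card ({..<P} \<times> {..<P})"
      using q(1,2) p(1) pq
    proof (rule exists_kwise_graph_of_blocks)
      show "finite ({..<P} \<times> {..<P})" by simp
      show "blk x \<subseteq> {1..N} \<and> card (blk x) = S" if "x \<in> {..<P} \<times> {..<P}" for x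
        using that by (rule blk)
      show "u = v" if "x \<in> {..<P} \<times> {..<P}" "y \<in> {..<P} \<times> {..<P}" "x \<noteq> y"
          "{u, v} \<subseteq> blk x" "{u, v} \<subseteq> blk y" for x y u v
        using that by (rule disj)
    qed
    then show ?thesis using that by blast
  qed
  have "(1 - 1 / real q ^ k) ^ card ({..<P} \<times> {..<P}) \<le> exp (- (real (P\<^sup>2) * (1 / real q ^ k)))"
    using one_minus_power_le_exp[of "1 / real q ^ k" "P\<^sup>2"] q0
    by (simp add: card_cartesian_product power2_eq_square)
  also have "\<dots> \<le> exp (- (z / (2 * real C))\<^sup>2)"
  proof -
    have "real N / (2 * real (S * C)) \<le> real P"
      using real_div_ge_half[OF SC] P(2) unfolding n_def by (meson le_trans of_nat_mono order_trans)
    then have "(real N / (2 * real (S * C)))\<^sup>2 \<le> (real P)\<^sup>2" by (intro power_mono) auto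
    moreover have "real q ^ k \<le> (real C * (real S)\<^sup>2) ^ k"
      using q(3) by (intro power_mono) (auto simp flip: of_nat_power of_nat_mult)
    ultimately have "(real N / (2 * real (S * C)))\<^sup>2 / (real C * (real S)\<^sup>2) ^ k \<le> (real P)\<^sup>2 / real q ^ k"
      using q0 by (intro frac_le) auto
    moreover have "(real N / (2 * real (S * C)))\<^sup>2 / (real C * (real S)\<^sup>2) ^ k =
        (z / (2 * real C))\<^sup>2 * (z\<^sup>2 / real C) ^ k"
    proof -
      have "(real N)\<^sup>2 = (z\<^sup>2) ^ k * z\<^sup>2 * (((real S)\<^sup>2) ^ k * (real S)\<^sup>2)"
        unfolding z(2) by (simp add: power_mult_distrib power2_eq_square algebra_simps)
      then show ?thesis using S C(1)
        by (simp add: power_mult_distrib power_divide field_simps)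
    qed
    moreover have "(z / (2 * real C))\<^sup>2 * 1 \<le> (z / (2 * real C))\<^sup>2 * (z\<^sup>2 / real C) ^ k"
    proof (intro mult_left_mono one_le_power)
      have "real C \<le> z" using z(1) C1 by linarith
      also have "z * 1 \<le> z * z" using z1 by (intro mult_left_mono) auto
      finally show "1 \<le> z\<^sup>2 / real C" using C(1) by (simp add: power2_eq_square)
    qed auto
    ultimately show ?thesis by simp
  qed
  finally have "1 - exp (- (z / (2 * real C))\<^sup>2) \<le>
      measure_pmf.prob G {E. \<exists>I. independent_set N E I \<and> card I = S}"
    using prob by linarith
  with G show ?thesis by blast
qed

theorem mainTheorem11:
  fixes S k :: "nat \<Rightarrow> nat" and p :: "nat \<Rightarrow> real"
  assumes S_pos: "\<And>N. S N > 0"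
    and k_pos: "\<And>N. k N > 0"
    and p_range: "\<And>N. 0 < p N \<and> p N < 1"
    and p_binary: "\<And>N. \<exists>l. has_binary_rep (p N) l"
    and p_length: "\<And>N. real (binary_length (p N)) \<le> 2 * log 2 (real (S N))"
    and S_small: "(\<lambda>N. real (S N) / real N powr (1 / (real (k N) + 1))) \<longlonglongrightarrow> 0"
  shows "\<exists>\<G> :: nat \<Rightarrow> nat set set pmf.
           kwise_independent_random_graph k p \<G> \<and>
           (\<lambda>N. measure_pmf.prob (\<G> N) {E. \<exists>I. independent_set N E I \<and> card I = S N})
             \<longlonglongrightarrow> 1"
proof -
  obtain C :: nat where C: "C > 0" "\<forall>n>0. \<exists>p. prime p \<and> n \<le> p \<and> p \<le> C * n"
    using prime_in_multiplicative_interval by (elim exE conjE)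
  \<comment> \<open>The smallness hypothesis says exactly that this reciprocal tends to
    infinity.\<close>
  define z where "z N = inverse (real (S N) / real N powr (1 / (real (k N) + 1)))" for N
  define has_indep where "has_indep N = {E. \<exists>I. independent_set N E I \<and> card I = S N}" for N
  define lower where "lower N = 1 - exp (- (z N / (2 * real C))\<^sup>2)" for N
  \<comment> \<open>The bound on the length \<open>l\<close> gives \<open>2 ^ l \<le> S ^ 2\<close>,
    so a number below 1 with \<open>l\<close> binary digits stays at least \<open>1 / S ^ 2\<close>
    away from 1.\<close>
  have p_le: "p N \<le> 1 - 1 / real (S N) ^ 2" for N
  proof -
    let ?l = "binary_length (p N)"
    have "has_binary_rep (p N) ?l"
      unfolding binary_length_def using p_binary by (rule LeastI_ex)
    then have "p N \<le> 1 - 1 / 2 ^ ?l" using p_range by (intro binary_rep_le_one_minus) auto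
    moreover have "(2::real) ^ ?l \<le> real (S N) ^ 2"
    proof -
      have "(2::real) ^ ?l = 2 powr real ?l" by (simp add: powr_realpow)
      also have "\<dots> \<le> 2 powr (2 * log 2 (real (S N)))" using p_length by (intro powr_mono) auto
      also have "\<dots> = (2 powr log 2 (real (S N))) ^ 2"
        by (simp add: power2_eq_square flip: powr_add)
      also have "\<dots> = real (S N) ^ 2" using S_pos[of N] by simp
      finally show ?thesis .
    qed
    then have "1 / real (S N) ^ 2 \<le> 1 / 2 ^ ?l" by (intro divide_left_mono) (use S_pos[of N] in auto)
    ultimately show ?thesis by linarith
  qed
  have "\<exists>G. subset_kwise (k N) (p N) (potential_edges N) G \<and>
      (N > 0 \<and> z N \<ge> 2 * real C \<longrightarrow> measure_pmf.prob G (has_indep N) \<ge> lower N)" for N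
  proof (cases "N > 0 \<and> z N \<ge> 2 * real C")
    case True
    have "(z N * real (S N)) ^ (k N + 1) = (real N powr (1 / (real (k N) + 1))) ^ (k N + 1)"
      using S_pos[of N] by (simp add: z_def)
    also have "\<dots> = real N powr (1 / (real (k N) + 1) * real (k N + 1))"
      using True by (subst powr_realpow[symmetric]) (auto simp: powr_powr)
    also have "\<dots> = real N" using True by (simp add: add.commute)
    finally have "real N = (z N * real (S N)) ^ (k N + 1)" by (rule sym)
    from exists_kwise_graph_with_independent_set[OF C(1) C(2)[rule_format] S_pos k_pos _ p_le _ this]
    have "\<exists>G. subset_kwise (k N) (p N) (potential_edges N) G \<and>
        measure_pmf.prob G (has_indep N) \<ge> lower N"
      using True p_range[of N] unfolding has_indep_def lower_def by simp
    then show ?thesis by blast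
  next
    case False
    \<comment> \<open>Here nothing is claimed about independent sets, so fully independent edges
      will do. As \<open>z\<close> tends to infinity, this affects only finitely many
      \<open>N\<close>.\<close>
    moreover have "\<exists>G. subset_kwise (k N) (p N) (potential_edges N) G"
      using subset_kwise_bernoulli[of "potential_edges N" "p N" "k N"] p_range[of N]
      by (auto intro: less_imp_le)
    ultimately show ?thesis by blast
  qed
  then obtain G where G: "\<And>N. subset_kwise (k N) (p N) (potential_edges N) (G N)"
      and G_prob: "\<And>N. N > 0 \<Longrightarrow> z N \<ge> 2 * real C \<Longrightarrow> measure_pmf.prob (G N) (has_indep N) \<ge> lower N"
    by metis
  have z_lim: "filterlim z at_top sequentially"
    unfolding z_def
  proof (rule filterlim_inverse_at_top[OF S_small])
    show "eventually (\<lambda>N. 0 < real (S N) / real N powr (1 / (real (k N) + 1))) sequentially"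
      using eventually_gt_at_top[of 0] by eventually_elim (use S_pos in auto)
  qed
  have "((\<lambda>x. 1 - exp (- (x / (2 * real C))\<^sup>2)) \<longlongrightarrow> 1) at_top"
    using C(1) by real_asymp
  then have lower_lim: "lower \<longlonglongrightarrow> 1"
    unfolding lower_def using z_lim by (rule filterlim_compose)
  have "(\<lambda>N. measure_pmf.prob (G N) (has_indep N)) \<longlonglongrightarrow> 1"
  proof (rule tendsto_sandwich[OF _ _ lower_lim tendsto_const])
    have "eventually (\<lambda>N. z N \<ge> 2 * real C) sequentially"
      using z_lim by (simp add: filterlim_at_top)
    then show "eventually (\<lambda>N. lower N \<le> measure_pmf.prob (G N) (has_indep N)) sequentially"
      using eventually_gt_at_top[of 0] by eventually_elim (rule G_prob)
  qed auto
  moreover have "kwise_independent_random_graph k p G"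
    using k_pos G by (rule kwise_independent_random_graphI)
  ultimately show ?thesis unfolding has_indep_def by blast
qed

end
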